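(* Let $F$ be a finite subset of $\mathbb{Z}$ with $0 \in F$, and let $A \subset \mathbb{Z}$ be a set such that $\mathbf{1}_F * \mathbf{1}_A$ is $\langle \ell \rangle$-periodic for some integer $\ell \ge 1$. Let $q$ be the least common multiple of $\ell$ and all the primes less than or equal to $2|F|$, and let $n$ be the least common multiple of $|f|$ over all $f \in F \setminus \{0\}$. Then $A$ is $\langle qn \rangle$-periodic.
   Context: $\mathbf{1}_S$ is the indicator function of $S$; $f*g(x) = \sum_{y \in \mathbb{Z}} f(y)g(x-y)$. A function $g$ on $\mathbb{Z}$ is $\langle h \rangle$-periodic if $g(x+h)=g(x)$ for all $x \in \mathbb{Z}$; a set is $\langle h\rangle$-periodic if its indicator function is. The least common multiple of the empty collection is $1$. $|F|$ denotes the cardinality of $F$, and $|f|$ the absolute value of the integer $f$. *)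

theory Defs
  imports
    "HOL-Computational_Algebra.Primes"
    "HOL-Library.Groups_Big_Fun"
    "HOL-Library.Indicator_Function"
begin

(* Sum_any, the sum over all y :: int, is 0 by convention if infinitely many terms are nonzero.
   When f or g has finite support, this is the usual convolution on the integers. *)
definition convolution :: "(int \<Rightarrow> int) \<Rightarrow> (int \<Rightarrow> int) \<Rightarrow> int \<Rightarrow> int"
  where "convolution f g x = Sum_any (\<lambda>y. f y * g (x - y))"

definition periodic_fun :: "int \<Rightarrow> (int \<Rightarrow> int) \<Rightarrow> bool"
  where "periodic_fun h g \<longleftrightarrow> (\<forall>x. g (x + h) = g x)"

definition periodic_set :: "int \<Rightarrow> int set \<Rightarrow> bool"
  where "periodic_set h S \<longleftrightarrow> periodic_fun h (indicator S)"

end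

theory Submission
  imports Defs "HOL-Library.Poly_Mapping"
begin

text \<open>
  Write \<open>g = 1\<^sub>F * 1\<^sub>A\<close>, so that \<open>g x = (\<Sum>f\<in>F. 1\<^sub>A (x - f))\<close>. The heart of the matter is a
  dilation property: for every \<open>r = 1 + k * q\<close> with \<open>k \<ge> 0\<close>, also
  \<open>g x = (\<Sum>f\<in>F. 1\<^sub>A (x - r * f))\<close>.

  Granting this, isolate the term of \<open>f = 0\<close>: it is \<open>1\<^sub>A x\<close>, whatever \<open>k\<close> is. For \<open>f \<noteq> 0\<close>, moving
  \<open>x\<close> by \<open>q * n\<close> turns \<open>1\<^sub>A (x - (1 + k * q) * f)\<close> into the same expression with \<open>k\<close> replaced by
  \<open>k - n / f\<close>. Since \<open>g\<close> is \<open>q * n\<close>-periodic, the increment \<open>1\<^sub>A x - 1\<^sub>A (x + q * n)\<close> is for each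
  \<open>k\<close> a sum, over \<open>f \<noteq> 0\<close>, of differences \<open>b (k + m) - b k\<close> of bounded sequences. Summed over
  \<open>k < N\<close> such differences telescope to a quantity bounded independently of \<open>N\<close>, whereas the
  constant increment contributes \<open>N\<close> times itself; hence it vanishes
  (\<open>constant_shift_difference_eq_0\<close>). This replaces the more usual limiting averages of the
  functions \<open>1\<^sub>A (x - (1 + k * q) * f)\<close>.

  The dilation property comes from the Frobenius map. In the group ring of the integers the
  \<open>p\<close>-th power of \<open>\<Sum>f\<in>F. X ^ f\<close> is congruent to \<open>\<Sum>f\<in>F. X ^ (p * f)\<close> modulo the prime \<open>p\<close>. Acting
  on \<open>1\<^sub>A\<close>, the former is a combination of translates of \<open>g\<close>, hence \<open>l\<close>-periodic; so
  \<open>\<Sum>f\<in>F. 1\<^sub>A (x - p * f)\<close> is \<open>l\<close>-periodic modulo \<open>p\<close>. Its values lie between \<open>0\<close> and \<open>|F|\<close>, so for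
  \<open>p > |F|\<close> it is genuinely \<open>l\<close>-periodic (\<open>periodic_prime_dilate\<close>). Iterating over the prime factors
  of \<open>r = 1 + k * q\<close>, all of which exceed \<open>|F|\<close>, gives \<open>l\<close>-periodicity of
  \<open>\<Sum>f\<in>F. 1\<^sub>A (x - r * f)\<close>. It differs from \<open>g x\<close> by a function that is constant along \<open>x + l\<int>\<close>, and
  since \<open>l\<close> divides \<open>r - 1\<close> the same telescoping argument shows that this constant is \<open>0\<close>.
\<close>

section \<open>Bounded sequences have no drift\<close>

text \<open>
  All terms cancel except about \<open>\<bar>m\<bar>\<close> at either end of the range; each unit step of \<open>m\<close> changes the
  sum by a single difference of two values of \<open>b\<close>.
\<close>
lemma abs_sum_shift_difference_le:
  fixes b :: "int \<Rightarrow> int"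
  assumes b: "\<And>k. 0 \<le> b k \<and> b k \<le> 1"
  shows "\<bar>\<Sum>k<N. b (int k + m) - b (int k)\<bar> \<le> \<bar>m\<bar>"
proof -
  define D where "D m = (\<Sum>k<N. b (int k + m) - b (int k))" for m
  have step: "D (m + 1) = D m + (b (int N + m) - b m)" for m
  proof -
    have "D (m + 1) - D m = (\<Sum>k<N. b (int (Suc k) + m) - b (int k + m))"
      unfolding D_def by (simp add: sum_subtractf algebra_simps)
    also have "\<dots> = b (int N + m) - b m"
      by (subst sum_lessThan_telescope) simp
    finally show ?thesis by simp
  qed
  have bnd: "\<bar>b i - b j\<bar> \<le> 1" for i j
    using b[of i] b[of j] by linarith
  have "\<bar>D m\<bar> \<le> \<bar>m\<bar>"
  proof (induction m rule: int_induct[where k = 0])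
    case base
    then show ?case by (simp add: D_def)
  next
    case (step1 i)
    then show ?case using step[of i] bnd[of "int N + i" i] by linarith
  next
    case (step2 i)
    then show ?case using step[of "i - 1"] bnd[of "int N + (i - 1)" "i - 1"] by simp
  qed
  then show ?thesis by (simp add: D_def)
qed

lemma constant_shift_difference_eq_0:
  fixes b :: "'i \<Rightarrow> int \<Rightarrow> int" and m :: "'i \<Rightarrow> int" and c :: int
  assumes b: "\<And>i k. 0 \<le> b i k \<and> b i k \<le> 1"
    and c: "\<And>k. (\<Sum>i\<in>I. b i (int k + m i) - b i (int k)) = c"
  shows "c = 0"
proof (rule ccontr)
  assume "c \<noteq> 0"
  define M where "M = (\<Sum>i\<in>I. \<bar>m i\<bar>)"
  have "M \<ge> 0" by (simp add: M_def sum_nonneg)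
  \<comment> \<open>Any number of terms exceeding the bound \<open>M\<close> on the telescoped sum will do.\<close>
  define N where "N = nat (M + 1)"
  have "int N * c = (\<Sum>k<N. \<Sum>i\<in>I. b i (int k + m i) - b i (int k))"
    by (simp add: c)
  also have "\<dots> = (\<Sum>i\<in>I. \<Sum>k<N. b i (int k + m i) - b i (int k))"
    by (rule sum.swap)
  finally have "\<bar>int N * c\<bar> \<le> (\<Sum>i\<in>I. \<bar>\<Sum>k<N. b i (int k + m i) - b i (int k)\<bar>)"
    by (simp only: sum_abs)
  also have "\<dots> \<le> M"
    unfolding M_def by (intro sum_mono abs_sum_shift_difference_le b)
  finally have "int N * \<bar>c\<bar> \<le> M" by (simp add: abs_mult)
  moreover have "int N * 1 \<le> int N * \<bar>c\<bar>"
    using \<open>c \<noteq> 0\<close> by (intro mult_left_mono) auto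
  moreover have "int N = M + 1" using \<open>M \<ge> 0\<close> by (simp add: N_def)
  ultimately show False by linarith
qed

section \<open>The group ring of the integers acting by convolution\<close>

lemma convolution_eq_sum:
  assumes "finite S" and "\<And>y. y \<notin> S \<Longrightarrow> f y = 0"
  shows "convolution f g x = (\<Sum>y\<in>S. f y * g (x - y))"
  unfolding convolution_def using assms by (intro Sum_any.expand_superset) auto

lemma convolution_indicator:
  assumes "finite F"
  shows "convolution (indicator F) g x = (\<Sum>f\<in>F. g (x - f))"
  using convolution_eq_sum[OF assms, of "indicator F"] by simp

text \<open>
  The group ring element \<open>P\<close> is thought of as the Laurent polynomial \<open>\<Sum>i. P\<^sub>i X ^ i\<close>, where \<open>X\<close> acts on
  functions as translation by \<open>1\<close>; convolution makes these functions a module over the ring.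
\<close>
abbreviation act :: "(int \<Rightarrow>\<^sub>0 int) \<Rightarrow> (int \<Rightarrow> int) \<Rightarrow> int \<Rightarrow> int"
  where "act P \<equiv> convolution (Poly_Mapping.lookup P)"

lemma act_single:
  "act (Poly_Mapping.single i c) g x = c * g (x - i)"
  by (subst convolution_eq_sum[of "{i}"]) (auto simp: lookup_single)

lemma act_of_nat:
  "act (of_nat k) g x = int k * g x"
  using act_single[of 0 "int k"] by simp

lemma act_add:
  "act (P + Q) g x = act P g x + act Q g x"
proof -
  have "act R g x
      = (\<Sum>y\<in>Poly_Mapping.keys P \<union> Poly_Mapping.keys Q. Poly_Mapping.lookup R y * g (x - y))"
    if "Poly_Mapping.keys R \<subseteq> Poly_Mapping.keys P \<union> Poly_Mapping.keys Q" for R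
    using that by (intro convolution_eq_sum) (auto simp: in_keys_iff)
  from this[of P] this[of Q] this[of "P + Q"] show ?thesis
    using keys_add[of P Q] by (simp add: lookup_add sum.distrib algebra_simps)
qed

lemma act_sum:
  "act (\<Sum>i\<in>I. P i) g x = (\<Sum>i\<in>I. act (P i) g x)"
proof (induction I rule: infinite_finite_induct)
  case (insert i I)
  then show ?case by (simp add: act_add)
qed (simp_all add: convolution_def)

lemma poly_mapping_sum_single:
  "(\<Sum>i\<in>Poly_Mapping.keys P. Poly_Mapping.single i (Poly_Mapping.lookup P i)) = P"
  by (rule poly_mapping_eqI) (auto simp: lookup_sum lookup_single when_def in_keys_iff sum.delta)

lemma act_mult:
  fixes P Q :: "int \<Rightarrow>\<^sub>0 int"
  shows "act (P * Q) g x = act P (act Q g) x"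
proof -
  \<comment> \<open>Both sides are biadditive, so only products of two monomials have to be compared.\<close>
  have single: "act (Poly_Mapping.single i c * Q) g x = c * act Q g (x - i)" for i c
  proof -
    have "Poly_Mapping.single i c * Q
        = (\<Sum>j\<in>Poly_Mapping.keys Q. Poly_Mapping.single (i + j) (c * Poly_Mapping.lookup Q j))"
      by (subst (1) poly_mapping_sum_single[of Q, symmetric])
        (simp add: sum_distrib_left mult_single)
    moreover have "act Q g (x - i)
        = (\<Sum>j\<in>Poly_Mapping.keys Q. Poly_Mapping.lookup Q j * g (x - i - j))"
      by (rule convolution_eq_sum) (auto simp: in_keys_iff)
    ultimately show ?thesis
      by (simp add: act_sum act_single sum_distrib_left algebra_simps)
  qed
  have "P * Q = (\<Sum>i\<in>Poly_Mapping.keys P. Poly_Mapping.single i (Poly_Mapping.lookup P i) * Q)"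
    by (subst (1) poly_mapping_sum_single[of P, symmetric]) (simp add: sum_distrib_right)
  moreover have "act P (act Q g) x
      = (\<Sum>i\<in>Poly_Mapping.keys P. Poly_Mapping.lookup P i * act Q g (x - i))"
    by (rule convolution_eq_sum) (auto simp: in_keys_iff)
  ultimately show ?thesis
    by (simp add: act_sum single)
qed

lemma periodic_fun_add_mult:
  assumes "periodic_fun l g"
  shows "g (x + l * k) = g x"
proof (induction k rule: int_induct[where k = 0])
  case (step1 i)
  then show ?case
    using assms[unfolded periodic_fun_def, rule_format, of "x + l * i"]
    by (simp add: algebra_simps)
next
  case (step2 i)
  then show ?case
    using assms[unfolded periodic_fun_def, rule_format, of "x + l * (i - 1)"]
    by (simp add: algebra_simps)
qed simp

lemma periodic_convolution:
  assumes "periodic_fun l g"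
  shows "periodic_fun l (convolution f g)"
proof -
  have "g (x + l - y) = g (x - y)" for x y
    using assms[unfolded periodic_fun_def, rule_format, of "x - y"] by (simp add: algebra_simps)
  then show ?thesis by (simp add: periodic_fun_def convolution_def)
qed

section \<open>The Frobenius map and dilations\<close>

lemma add_power_prime_dvd:
  fixes a b :: "'a :: comm_ring_1"
  assumes p: "prime p"
  shows "of_nat p dvd (a + b) ^ p - (a ^ p + b ^ p)"
proof -
  obtain p' where p': "p = Suc p'" using p prime_gt_0_nat[of p] by (cases p) auto
  have "(a + b) ^ p = (\<Sum>k\<le>p. of_nat (p choose k) * a ^ k * b ^ (p - k))"
    by (rule binomial_ring)
  also have "{..p} = insert 0 (insert p {0<..<p})" using p' by auto
  also have "(\<Sum>k\<in>\<dots>. of_nat (p choose k) * a ^ k * b ^ (p - k))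
      = a ^ p + b ^ p + (\<Sum>k\<in>{0<..<p}. of_nat (p choose k) * a ^ k * b ^ (p - k))"
    using p' by (simp add: algebra_simps)
  finally have "(a + b) ^ p - (a ^ p + b ^ p)
      = (\<Sum>k\<in>{0<..<p}. of_nat (p choose k) * a ^ k * b ^ (p - k))" by simp
  also have "of_nat p dvd \<dots>"
  proof (intro dvd_sum dvd_mult2)
    fix k assume "k \<in> {0<..<p}"
    then have "p dvd p choose k" using p by (intro dvd_choose_prime) auto
    then show "(of_nat p :: 'a) dvd of_nat (p choose k)" by (metis dvd_def of_nat_mult)
  qed
  finally show ?thesis .
qed

lemma sum_power_prime_dvd:
  fixes a :: "'i \<Rightarrow> 'a :: comm_ring_1"
  assumes p: "prime p"
  shows "of_nat p dvd (\<Sum>i\<in>I. a i) ^ p - (\<Sum>i\<in>I. a i ^ p)"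
proof (induction I rule: infinite_finite_induct)
  case (insert i I)
  from dvd_add[OF add_power_prime_dvd[OF p, of "a i" "\<Sum>i\<in>I. a i"] insert.IH]
  show ?case using insert.hyps by (simp add: algebra_simps)
qed (use prime_gt_0_nat[OF p] in \<open>simp_all add: power_0_left\<close>)

lemma single_power:
  fixes i :: int
  shows "Poly_Mapping.single i (1 :: int) ^ k = Poly_Mapping.single (int k * i) 1"
  by (induction k) (simp_all add: mult_single algebra_simps)

text \<open>
  The \<open>p\<close>-th power of the group ring element \<open>\<Sum>i\<in>I. X ^ t i\<close> carries \<open>g\<close> to an \<open>l\<close>-periodic function,
  and agrees modulo \<open>p\<close> with \<open>\<Sum>i\<in>I. X ^ (p * t i)\<close>. The bound on \<open>card I\<close> then upgrades periodicity
  modulo \<open>p\<close> to periodicity. Families rather than sets of translations allow the lemma to be iterated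
  without tracking the injectivity of dilations.
\<close>
lemma periodic_prime_dilate:
  fixes g :: "int \<Rightarrow> int" and t :: "'i \<Rightarrow> int"
  assumes p: "prime p" and card: "card I < p"
    and g: "\<And>x. 0 \<le> g x \<and> g x \<le> 1"
    and per: "periodic_fun l (\<lambda>x. \<Sum>i\<in>I. g (x - t i))"
  shows "periodic_fun l (\<lambda>x. \<Sum>i\<in>I. g (x - int p * t i))"
proof -
  define u :: "int \<Rightarrow>\<^sub>0 int" where "u = (\<Sum>i\<in>I. Poly_Mapping.single (t i) 1)"
  define v :: "int \<Rightarrow>\<^sub>0 int" where "v = (\<Sum>i\<in>I. Poly_Mapping.single (int p * t i) 1)"
  define h where "h x = (\<Sum>i\<in>I. g (x - int p * t i))" for x
  have u: "act u g = (\<lambda>x. \<Sum>i\<in>I. g (x - t i))"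
    by (simp only: fun_eq_iff u_def act_sum act_single mult_1) simp
  have v: "act v g = h"
    by (simp only: fun_eq_iff v_def h_def act_sum act_single mult_1) simp
  have "of_nat p dvd u ^ p - v"
    using sum_power_prime_dvd[OF p, of "\<lambda>i. Poly_Mapping.single (t i) (1 :: int)" I]
    by (simp add: u_def v_def single_power)
  then obtain R where "u ^ p - v = of_nat p * R" by (rule dvdE)
  then have R: "u ^ p = v + of_nat p * R"
    by (simp add: algebra_simps)
  have "u ^ p = u ^ (p - 1) * u"
    using prime_gt_0_nat[OF p] by (simp add: power_eq_if mult.commute)
  then have "act (u ^ p) g = act (u ^ (p - 1)) (\<lambda>x. \<Sum>i\<in>I. g (x - t i))"
    by (simp add: fun_eq_iff act_mult u)
  then have per_power: "periodic_fun l (act (u ^ p) g)"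
    using periodic_convolution[OF per] by simp
  have power: "act (u ^ p) g x = h x + int p * act R g x" for x
    by (simp add: R act_add act_mult act_of_nat v)
  have "h (x + l) = h x" for x
  proof -
    have "h (x + l) - h x
        = int p * (act R g x - act R g (x + l))"
      using per_power[unfolded periodic_fun_def, rule_format, of x]
      unfolding power right_diff_distrib by linarith
    then have dvd: "int p dvd h (x + l) - h x" by simp
    have "0 \<le> h y \<and> h y \<le> int (card I)" for y
      using sum_bounded_above[of I "\<lambda>i. g (y - int p * t i)" 1] g
      by (auto simp: h_def intro: sum_nonneg)
    from this[of x] this[of "x + l"] have "\<bar>h (x + l) - h x\<bar> < int p"
      using card by linarith
    then show ?thesis using dvd dvd_imp_le_int[of "h (x + l) - h x" "int p"] by fastforce
  qed
  then show ?thesis by (simp add: periodic_fun_def h_def)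
qed

lemma periodic_dilate:
  fixes g :: "int \<Rightarrow> int" and t :: "'i \<Rightarrow> int"
  assumes "r \<noteq> 0" and "\<And>p. prime p \<Longrightarrow> p dvd r \<Longrightarrow> card I < p"
    and g: "\<And>x. 0 \<le> g x \<and> g x \<le> 1"
    and per: "periodic_fun l (\<lambda>x. \<Sum>i\<in>I. g (x - t i))"
  shows "periodic_fun l (\<lambda>x. \<Sum>i\<in>I. g (x - int r * t i))"
  using assms(1,2)
proof (induction r rule: prime_divisors_induct)
  case zero
  then show ?case by simp
next
  case (unit r)
  then show ?case using per by simp
next
  case (factor p r)
  have "periodic_fun l (\<lambda>x. \<Sum>i\<in>I. g (x - int r * t i))"
    using factor by auto
  from periodic_prime_dilate[OF factor.hyps _ g this] factor show ?case
    by (simp add: mult.assoc)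
qed

text \<open>
  Both sides are \<open>l\<close>-periodic, so their difference at \<open>x + l * k\<close> does not depend on \<open>k\<close>. Since \<open>l\<close>
  divides \<open>r - 1\<close>, the points \<open>x - r * t i\<close> and \<open>x - t i\<close> lie in the same class modulo \<open>l\<close>: the
  difference has no drift, so it is \<open>0\<close>.
\<close>
lemma sum_dilate_eq:
  fixes g :: "int \<Rightarrow> int" and t :: "'i \<Rightarrow> int"
  assumes "r \<noteq> 0" and "\<And>p. prime p \<Longrightarrow> p dvd r \<Longrightarrow> card I < p"
    and dvd: "l dvd int r - 1"
    and g: "\<And>x. 0 \<le> g x \<and> g x \<le> 1"
    and per: "periodic_fun l (\<lambda>x. \<Sum>i\<in>I. g (x - t i))"
  shows "(\<Sum>i\<in>I. g (x - int r * t i)) = (\<Sum>i\<in>I. g (x - t i))"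
proof -
  obtain s where s: "int r = 1 + l * s" using dvd by (auto simp: dvd_def algebra_simps)
  define b where "b i k = g (x - t i + l * k)" for i k
  have "(\<Sum>i\<in>I. g (x - int r * t i)) - (\<Sum>i\<in>I. g (x - t i)) = 0"
  proof (rule constant_shift_difference_eq_0[where I = I and b = b and m = "\<lambda>i. - (s * t i)"])
    show "0 \<le> b i k \<and> b i k \<le> 1" for i k by (simp add: b_def g)
    fix k
    have "b i (int k + - (s * t i)) = g (x + l * int k - int r * t i)"
      and "b i (int k) = g (x + l * int k - t i)" for i
      unfolding b_def s by (simp_all add: algebra_simps)
    then show "(\<Sum>i\<in>I. b i (int k + - (s * t i)) - b i (int k))
        = (\<Sum>i\<in>I. g (x - int r * t i)) - (\<Sum>i\<in>I. g (x - t i))"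
      using periodic_fun_add_mult[OF per, of x k]
        periodic_fun_add_mult[OF periodic_dilate[OF assms(1,2) g per], of x k]
      by (simp add: sum_subtractf)
  qed
  then show ?thesis by simp
qed

section \<open>Periodicity\<close>

theorem corollary3p5:
  fixes F A :: "int set" and l q n :: int
  assumes "finite F" and "0 \<in> F"
    and "l \<ge> 1"
    and "periodic_fun l (convolution (indicator F) (indicator A))"
    and "q = Lcm (insert l {p. prime p \<and> p \<le> 2 * int (card F)})"
    and "n = Lcm ((\<lambda>f. \<bar>f\<bar>) ` (F - {0}))"
  shows "periodic_set (q * n) A"
proof -
  define a :: "int \<Rightarrow> int" where "a = indicator A"
  have a: "0 \<le> a x \<and> a x \<le> 1" for x by (simp add: a_def indicator_def)
  have per: "periodic_fun l (\<lambda>x. \<Sum>f\<in>F. a (x - f))"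
    using assms(4) by (simp add: a_def periodic_fun_def convolution_indicator[OF assms(1)])
  have q_nonneg: "q \<ge> 0" unfolding assms(5) by simp
  have l_dvd: "l dvd q" unfolding assms(5) by (rule dvd_Lcm) simp
  have dilate: "(\<Sum>f\<in>F. a (x - (1 + int k * q) * f)) = (\<Sum>f\<in>F. a (x - f))" for x k
  proof -
    define r where "r = nat (1 + int k * q)"
    have r: "int r = 1 + int k * q" using q_nonneg by (simp add: r_def)
    have "card F < p" if p: "prime p" "p dvd r" for p
    proof (rule ccontr)
      assume "\<not> card F < p"
      then have "int p dvd q"
        unfolding assms(5) using p by (intro dvd_Lcm) auto
      moreover have "int p dvd 1 + int k * q" using p(2) r by (metis int_dvd_int_iff)
      ultimately have "int p dvd 1" by (metis dvd_add_left_iff dvd_mult)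
      then show False using p(1) by simp
    qed
    moreover have "r \<noteq> 0" using q_nonneg by (simp add: r_def not_le add_pos_nonneg)
    moreover have "l dvd int r - 1" using l_dvd by (simp add: r)
    ultimately show ?thesis
      using sum_dilate_eq[OF _ _ _ a per, of r x] unfolding r by blast
  qed
  have per_qn: "(\<Sum>f\<in>F. a (x + q * n - f)) = (\<Sum>f\<in>F. a (x - f))" for x
  proof -
    obtain s where "q = l * s" using l_dvd by (rule dvdE)
    then show ?thesis
      using periodic_fun_add_mult[OF per, of x "s * n"] by (simp add: mult.assoc)
  qed
  have "a (x + q * n) = a x" for x
  proof -
    define b where "b f k = a (x - f - q * f * k)" for f k
    have "a x - a (x + q * n) = 0"
    proof (rule constant_shift_difference_eq_0[where I = "F - {0}" and b = b and
          m = "\<lambda>f. - (n div f)"])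
      show "0 \<le> b f k \<and> b f k \<le> 1" for f k by (simp add: b_def a)
      fix k
      have shift: "b f (int k + - (n div f)) = a (x + q * n - (1 + int k * q) * f)"
        if "f \<in> F - {0}" for f
      proof -
        have "\<bar>f\<bar> dvd n" unfolding assms(6) using that by (intro dvd_Lcm) auto
        then have "f * (n div f) = n" by simp
        then have "q * f * (int k + - (n div f)) = q * f * int k - q * n"
          by (simp only: distrib_left mult_minus_right mult.assoc)
        then have "x - f - q * f * (int k + - (n div f)) = x + q * n - (1 + int k * q) * f"
          by (simp only:) (simp add: algebra_simps)
        then show ?thesis by (simp only: b_def)
      qed
      have no_shift: "b f (int k) = a (x - (1 + int k * q) * f)" for f
        by (simp add: b_def algebra_simps)
      have isolate: "(\<Sum>f\<in>F - {0}. a (y - (1 + int k * q) * f)) = (\<Sum>f\<in>F. a (y - f)) - a y"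
        for y
        using dilate[of y k] sum.remove[OF assms(1,2), of "\<lambda>f. a (y - (1 + int k * q) * f)"]
        by simp
      have "(\<Sum>f\<in>F - {0}. b f (int k + - (n div f)) - b f (int k))
          = (\<Sum>f\<in>F - {0}. a (x + q * n - (1 + int k * q) * f) - a (x - (1 + int k * q) * f))"
        by (intro sum.cong refl arg_cong2[where f = "(-)"] shift no_shift)
      also have "\<dots> = a x - a (x + q * n)"
        unfolding sum_subtractf isolate per_qn by simp
      finally show "(\<Sum>f\<in>F - {0}. b f (int k + - (n div f)) - b f (int k)) = a x - a (x + q * n)" .
    qed
    then show ?thesis by simp
  qed
  then show ?thesis by (simp add: periodic_set_def periodic_fun_def a_def)
qed

end
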